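(* Let $n\ge1$, $\alpha\in\mathbb{R}\setminus\pi\mathbb{Z}$ and $b\in\mathrm{BMO}_\alpha(\mathbb{R}^n)$. Then there exist constants $C_1,C_2>0$, depending only on the dimension $n$, such that for every cube $Q\subset\mathbb{R}^n$ and every $\lambda>0$, $$\bigl|\{x\in Q:|M_\alpha b(x)-\mathrm{Avg}_Q(M_\alpha b)|>\lambda\}\bigr|\le C_1|Q|\exp\Bigl(-\frac{C_2\lambda}{\|b\|_{\mathrm{BMO}_\alpha}}\Bigr).$$
   Context: $M_\alpha f(x)=e^{i\pi|x|^2\cot\alpha}f(x)$. $\mathrm{Avg}_Q(g)=\frac1{|Q|}\int_Qg$. The classical seminorm is $\|g\|_{\mathrm{BMO}}:=\sup_Q\frac1{|Q|}\int_Q|g(x)-\mathrm{Avg}_Q(g)|\,dx$, the supremum being over cubes $Q\subset\mathbb{R}^n$. $\mathrm{BMO}_\alpha(\mathbb{R}^n):=\{b\in\mathcal S'(\mathbb{R}^n):M_\alpha b\in\mathrm{BMO}(\mathbb{R}^n)\}$ with $\|b\|_{\mathrm{BMO}_\alpha}:=\|M_\alpha b\|_{\mathrm{BMO}}$. When $\|b\|_{\mathrm{BMO}_\alpha}=0$ the exponential on the right is read as $0$. *)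

theory Defs
  imports "HOL-Analysis.Analysis"
begin

subsection \<open>Schwartz functions and tempered distributions\<close>

primrec iter_partial :: "'n list \<Rightarrow> (real ^ 'n \<Rightarrow> complex) \<Rightarrow> real ^ 'n \<Rightarrow> complex" where
  "iter_partial [] f = f"
| "iter_partial (i # is) f = (\<lambda>x. frechet_derivative (iter_partial is f) (at x) (axis i 1))"

definition schwartz_seminorm :: "nat \<Rightarrow> 'n list \<Rightarrow> (real ^ 'n \<Rightarrow> complex) \<Rightarrow> real" where
  "schwartz_seminorm k is f = (SUP x. norm x ^ k * cmod (iter_partial is f x))"

text \<open>The list of indices plays the role of a multi-index; the first condition says that \<open>f\<close> is
  infinitely differentiable.\<close>

definition schwartz :: "(real ^ 'n \<Rightarrow> complex) set" where
  "schwartz = {f. (\<forall>is. iter_partial is f differentiable_on UNIV) \<and>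
     (\<forall>k is. bdd_above (range (\<lambda>x. norm x ^ k * cmod (iter_partial is f x))))}"

definition schwartz_topology :: "(real ^ 'n \<Rightarrow> complex) topology" where
  "schwartz_topology = topology_generated_by
     {{g \<in> schwartz. schwartz_seminorm k is (\<lambda>x. g x - f x) < e} | f k is e. f \<in> schwartz \<and> e > 0}"

text \<open>A distribution is a functional on all functions of which only the values on Schwartz functions
  are relevant.\<close>

type_synonym 'n functional = "(real ^ 'n \<Rightarrow> complex) \<Rightarrow> complex"

definition tempered_distribution :: "('n :: finite) functional \<Rightarrow> bool" where
  "tempered_distribution T \<longleftrightarrow>
     (\<forall>f\<in>schwartz. \<forall>g\<in>schwartz. \<forall>c d. T (\<lambda>x. c * f x + d * g x) = c * T f + d * T g) \<and>
     continuous_map schwartz_topology euclidean T"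

definition represents :: "(real ^ 'n :: finite \<Rightarrow> complex) \<Rightarrow> 'n functional \<Rightarrow> bool" where
  "represents g T \<longleftrightarrow> (\<forall>f\<in>schwartz. integrable lebesgue (\<lambda>x. g x * f x) \<and>
     T f = (LINT x|lebesgue. g x * f x))"

subsection \<open>Functions of bounded mean oscillation\<close>

text \<open>Cubes have sides parallel to the coordinate axes and positive side length. Taking them closed
  is immaterial, as their boundary has measure zero.\<close>

definition cubes :: "(real ^ 'n) set set" where
  "cubes = {cbox a (a + (\<chi> i. s)) | a s. s > 0}"

definition Avg :: "(real ^ 'n) set \<Rightarrow> (real ^ 'n \<Rightarrow> complex) \<Rightarrow> complex" where
  "Avg Q g = (LINT x:Q|lebesgue. g x) / of_real (measure lebesgue Q)"

definition mean_osc :: "(real ^ 'n) set \<Rightarrow> (real ^ 'n \<Rightarrow> complex) \<Rightarrow> real" where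
  "mean_osc Q g = (LINT x:Q|lebesgue. cmod (g x - Avg Q g)) / measure lebesgue Q"

definition locally_integrable :: "(real ^ 'n \<Rightarrow> complex) \<Rightarrow> bool" where
  "locally_integrable g \<longleftrightarrow> (\<forall>K. compact K \<longrightarrow> g absolutely_integrable_on K)"

definition bmo_seminorm :: "(real ^ 'n \<Rightarrow> complex) \<Rightarrow> real" where
  "bmo_seminorm g = (SUP Q\<in>cubes. mean_osc Q g)"

definition BMO :: "(real ^ 'n \<Rightarrow> complex) set" where
  "BMO = {g. locally_integrable g \<and> bdd_above ((\<lambda>Q. mean_osc Q g) ` cubes)}"

subsection \<open>The chirp multiplier and the space \<open>BMO_alpha\<close>\<close>

definition chirp :: "real \<Rightarrow> (real ^ 'n \<Rightarrow> complex) \<Rightarrow> real ^ 'n \<Rightarrow> complex" where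
  "chirp \<alpha> f x = exp (\<i> * of_real (pi * (norm x)\<^sup>2 * cot \<alpha>)) * f x"

text \<open>On distributions, multiplication by a smooth function acts by transposition.\<close>

definition chirp_distr :: "real \<Rightarrow> ('n :: finite) functional \<Rightarrow> 'n functional" where
  "chirp_distr \<alpha> T f = T (chirp \<alpha> f)"

definition BMO_alpha :: "real \<Rightarrow> ('n :: finite) functional set" where
  "BMO_alpha \<alpha> = {b. tempered_distribution b \<and> (\<exists>g\<in>BMO. represents g (chirp_distr \<alpha> b))}"

text \<open>The choice of \<open>g\<close> does not matter: two locally integrable functions that represent the same
  distribution agree almost everywhere and hence have the same seminorm.\<close>

definition bmo_alpha_norm :: "real \<Rightarrow> ('n :: finite) functional \<Rightarrow> real" where
  "bmo_alpha_norm \<alpha> b = bmo_seminorm (SOME g. g \<in> BMO \<and> represents g (chirp_distr \<alpha> b))"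

end

theory Submission
  imports Defs
begin

text \<open>
  Once \<open>Mb\<close> is known to agree almost everywhere with the function defining the norm, the claim is the
  John--Nirenberg inequality. The agreement follows by testing against smooth bumps with support in
  a box that increase to its indicator function. For the inequality, a Calderon--Zygmund
  decomposition of \<open>Q\<close> at height \<open>2 B\<close>, where \<open>B\<close> bounds the mean oscillations, yields disjoint
  dyadic subcubes of total measure at most \<open>|Q| / 2\<close>, off which the oscillation is at most \<open>2 B\<close>
  and on which the average differs from that of \<open>Q\<close> by at most \<open>2 ^ (n + 1) B\<close>. Iterating
  \<open>m\<close> times, the oscillation exceeds \<open>2 ^ (n + 1) B m\<close> on a set of measure at most \<open>|Q| / 2 ^ m\<close>.
\<close>

subsection \<open>Functions representing the same distribution\<close>

text \<open>The functions \<open>flat p\<close> are closed under differentiation and contain the standard example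
  \<open>flat 1\<close> of a smooth function that vanishes exactly on the half-line \<open>t \<le> 0\<close>.\<close>

definition flat :: "real poly \<Rightarrow> real \<Rightarrow> real" where
  "flat p t = (if t > 0 then poly p (inverse t) * exp (- inverse t) else 0)"

text \<open>Under the substitution \<open>x = 1 / t\<close> this is the decay of every
  \<open>flat p\<close> as \<open>t\<close> tends to 0 from the right.\<close>

lemma tendsto_poly_mult_exp_uminus:
  fixes p :: "real poly"
  shows "((\<lambda>x. poly p x * exp (- x)) \<longlongrightarrow> 0) at_top"
proof -
  have "((\<lambda>x. \<Sum>i\<le>degree p. coeff p i * (x ^ i / exp x)) \<longlongrightarrow> (\<Sum>i\<le>degree p. coeff p i * 0)) at_top"
    by (intro tendsto_sum tendsto_mult tendsto_const tendsto_power_div_exp_0)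
  then show ?thesis
    by (simp add: poly_altdef sum_divide_distrib exp_minus field_simps)
qed

text \<open>For \<open>t > 0\<close> the product and chain rules give \<open>(p - pderiv p)\<close>
  at \<open>1 / t\<close> times \<open>exp (- 1 / t) / t ^ 2\<close>, and \<open>1 / t ^ 2\<close>
  is the polynomial \<open>X ^ 2\<close> at \<open>1 / t\<close>. At 0 the exponential decay beats
  every power of \<open>1 / t\<close>, so both one-sided derivatives are 0.\<close>

lemma has_real_derivative_flat:
  "(flat p has_real_derivative flat ([:0, 0, 1:] * (p - pderiv p)) t) (at t)"
proof (cases t "0 :: real" rule: linorder_cases)
  case less
  have "((\<lambda>_. 0) has_real_derivative 0) (at t)" by simp
  then have "(flat p has_real_derivative 0) (at t)"
    by (rule has_field_derivative_transform_within_open[of _ _ _ "{..<0}"])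
      (use less in \<open>auto simp: flat_def\<close>)
  then show ?thesis using less by (simp add: flat_def)
next
  case greater
  have "((\<lambda>t. poly p (inverse t) * exp (- inverse t)) has_real_derivative
      flat ([:0, 0, 1:] * (p - pderiv p)) t) (at t)"
    using greater unfolding flat_def
    by (auto intro!: derivative_eq_intros simp: power2_eq_square field_simps)
  then show ?thesis
    by (rule has_field_derivative_transform_within_open[of _ _ _ "{0<..}"])
      (use greater in \<open>auto simp: flat_def\<close>)
next
  case equal
  have "((\<lambda>h. flat p h / h) \<longlongrightarrow> 0) (at_left 0)"
    by (rule tendsto_eventually) (auto simp: eventually_at_filter flat_def)
  moreover have "((\<lambda>h. flat p h / h) \<longlongrightarrow> 0) (at_right 0)"
  proof -
    \<comment> \<open>The division by \<open>h\<close> is absorbed into the polynomial, as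
      multiplication by \<open>X\<close>.\<close>
    have "((\<lambda>h. poly ([:0, 1:] * p) (inverse h) * exp (- inverse h)) \<longlongrightarrow> 0) (at_right 0)"
      by (rule filterlim_compose[OF tendsto_poly_mult_exp_uminus filterlim_inverse_at_top_right])
    then show ?thesis
      by (rule Lim_transform_eventually)
        (auto simp: eventually_at_filter flat_def field_simps)
  qed
  ultimately have "((\<lambda>h. flat p h / h) \<longlongrightarrow> 0) (at 0)"
    by (simp add: filterlim_split_at)
  then show ?thesis
    using equal by (simp add: DERIV_def flat_def)
qed

text \<open>An algebra of functions closed under partial derivatives, so that all its members are smooth.\<close>

inductive smooth_alg :: "(real ^ 'n \<Rightarrow> complex) \<Rightarrow> bool" where
  const: "smooth_alg (\<lambda>_. c)"
| flat: "smooth_alg (\<lambda>x. of_real (flat p (k * x $ i + d)))"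
| add: "smooth_alg f \<Longrightarrow> smooth_alg g \<Longrightarrow> smooth_alg (\<lambda>x. f x + g x)"
| mult: "smooth_alg f \<Longrightarrow> smooth_alg g \<Longrightarrow> smooth_alg (\<lambda>x. f x * g x)"

text \<open>The sum and product rules express the partial derivatives through the functions and
  their partial derivatives, so the algebra contains them again.\<close>

lemma smooth_alg_has_derivative:
  fixes f :: "real ^ 'n :: finite \<Rightarrow> complex"
  assumes "smooth_alg f"
  shows "\<exists>f'. (\<forall>x. (f has_derivative f' x) (at x)) \<and> (\<forall>i. smooth_alg (\<lambda>x. f' x (axis i 1)))"
  using assms
proof induction
  case (const c)
  show ?case
    by (rule exI[of _ "\<lambda>x h. 0"]) (auto intro: smooth_alg.const)
next
  case (flat p k i d)
  define q where "q = [:0, 0, 1:] * (p - pderiv p)"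
  let ?f' = "\<lambda>(x::real^'n) (h::real^'n). complex_of_real (flat q (k * x $ i + d)) * of_real (k * h $ i)"
  have "((\<lambda>x. complex_of_real (flat p (k * x $ i + d))) has_derivative ?f' x) (at x)" for x
  proof -
    have "((\<lambda>x. k * x $ i + d) has_derivative (\<lambda>h. k * h $ i)) (at x)"
      by (auto intro!: derivative_eq_intros bounded_linear.has_derivative[OF bounded_linear_vec_nth])
    from DERIV_compose_FDERIV[OF has_real_derivative_flat this]
    have "((\<lambda>x. flat p (k * x $ i + d)) has_derivative (\<lambda>h. k * h $ i * flat q (k * x $ i + d))) (at x)"
      by (simp add: q_def)
    from has_derivative_of_real[OF this] show ?thesis by (simp add: mult.commute)
  qed
  moreover have "smooth_alg (\<lambda>x. ?f' x (axis j 1))" for j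
    by (rule smooth_alg.mult[OF smooth_alg.flat smooth_alg.const])
  ultimately show ?case by (intro exI[of _ ?f']) blast
next
  case (add f g)
  then obtain f' g' where "\<And>x. (f has_derivative f' x) (at x)" "\<And>i. smooth_alg (\<lambda>x. f' x (axis i 1))"
    "\<And>x. (g has_derivative g' x) (at x)" "\<And>i. smooth_alg (\<lambda>x. g' x (axis i 1))"
    by blast
  then show ?case
    by (intro exI[of _ "\<lambda>x h. f' x h + g' x h"]) (auto intro: has_derivative_add smooth_alg.add)
next
  case (mult f g)
  then obtain f' g' where "\<And>x. (f has_derivative f' x) (at x)" "\<And>i. smooth_alg (\<lambda>x. f' x (axis i 1))"
    "\<And>x. (g has_derivative g' x) (at x)" "\<And>i. smooth_alg (\<lambda>x. g' x (axis i 1))"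
    by blast
  with mult show ?case
    by (intro exI[of _ "\<lambda>x h. f x * g' x h + f' x h * g x"])
      (auto intro!: has_derivative_mult smooth_alg.add smooth_alg.mult)
qed

section \<open>Smooth functions supported in a box are Schwartz functions\<close>

lemma smooth_alg_differentiable:
  fixes f :: "real ^ 'n :: finite \<Rightarrow> complex"
  assumes "smooth_alg f"
  shows "f differentiable at x"
  using smooth_alg_has_derivative[OF assms] differentiable_def by blast

lemma smooth_alg_iter_partial:
  fixes f :: "real ^ 'n :: finite \<Rightarrow> complex"
  assumes "smooth_alg f"
  shows "smooth_alg (iter_partial is f)"
proof (induction "is")
  case (Cons i "is")
  obtain f' where f': "\<And>x. (iter_partial is f has_derivative f' x) (at x)"
    "smooth_alg (\<lambda>x. f' x (axis i 1))"
    using smooth_alg_has_derivative[OF Cons] by blast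
  have "iter_partial (i # is) f = (\<lambda>x. f' x (axis i 1))"
    using frechet_derivative_at[OF f'(1)] by auto
  with f'(2) show ?case by metis
qed (use assms in simp)

text \<open>A derivative at a point of an open set depends only on the values in that set, so
  vanishing on \<open>U\<close> survives each differentiation.\<close>

lemma iter_partial_eq_0:
  fixes f :: "real ^ 'n :: finite \<Rightarrow> complex"
  assumes "open U" "\<And>x. x \<in> U \<Longrightarrow> f x = 0" "x \<in> U"
  shows "iter_partial is f x = 0"
  using assms(3)
proof (induction "is" arbitrary: x)
  case (Cons i "is")
  have "((\<lambda>_. 0) has_derivative (\<lambda>_. 0)) (at x)" by simp
  then have "(iter_partial is f has_derivative (\<lambda>_. 0)) (at x)"
    by (rule has_derivative_transform_within_open[OF _ assms(1) Cons.prems]) (use Cons.IH in auto)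
  then show ?case
    by (simp flip: frechet_derivative_at)
qed (use assms in simp)

text \<open>Every iterated partial derivative stays in the algebra, hence is continuous and bounded
  on the compact box; on the open complement it vanishes.\<close>

lemma smooth_alg_schwartz:
  fixes f :: "real ^ 'n :: finite \<Rightarrow> complex"
  assumes f: "smooth_alg f" and 0: "\<And>x. x \<notin> cbox a b \<Longrightarrow> f x = 0"
  shows "f \<in> schwartz"
  unfolding schwartz_def
proof (safe)
  fix "is" show "iter_partial is f differentiable_on UNIV"
    using smooth_alg_differentiable[OF smooth_alg_iter_partial[OF f]]
    by (auto simp: differentiable_on_def)
next
  fix k "is"
  let ?g = "\<lambda>x. norm x ^ k * cmod (iter_partial is f x)"
  have "continuous_on (cbox a b) (iter_partial is f)"
    using smooth_alg_differentiable[OF smooth_alg_iter_partial[OF f]]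
    by (intro differentiable_imp_continuous_on) (auto simp: differentiable_on_def intro: differentiable_at_withinI)
  then have "continuous_on (cbox a b) ?g"
    by (intro continuous_intros)
  then have "compact (?g ` cbox a b)"
    by (rule compact_continuous_image) auto
  then obtain B where B: "\<And>x. x \<in> cbox a b \<Longrightarrow> ?g x \<le> B"
    by (meson bounded_imp_bdd_above compact_imp_bounded bdd_above.E imageI)
  \<comment> \<open>The maximum with 0 covers the points off the box; if the box is empty,
    \<open>B\<close> may be negative.\<close>
  have "?g x \<le> max B 0" for x
  proof (cases "x \<in> cbox a b")
    case False
    have "iter_partial is f x = 0"
      by (rule iter_partial_eq_0[of "- cbox a b"]) (use 0 False in auto)
    then show ?thesis by simp
  qed (use B[of x] in auto)
  then show "bdd_above (range ?g)" by (meson bdd_above.I2)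
qed

section \<open>Smooth bumps approximating the indicator of a box\<close>

text \<open>There is one factor for each face of the box. At an inner point, the scaling by
  \<open>k\<close> drives every factor to 1.\<close>

definition bump :: "real ^ 'n \<Rightarrow> real ^ 'n \<Rightarrow> nat \<Rightarrow> real ^ 'n \<Rightarrow> real" where
  "bump a b k x = (\<Prod>i\<in>UNIV. flat 1 (real k * (x $ i - a $ i)) * flat 1 (real k * (b $ i - x $ i)))"

lemma flat_1_bounds: "0 \<le> flat 1 t" "flat 1 t \<le> 1"
  by (auto simp: flat_def)

lemma bump_bounds: "0 \<le> bump a b k x" "bump a b k x \<le> 1"
  unfolding bump_def by (auto intro!: prod_nonneg prod_le_1 mult_le_one mult_nonneg_nonneg flat_1_bounds)

lemma bump_eq_0:
  fixes x :: "real ^ 'n :: finite"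
  assumes "x \<notin> box a b"
  shows "bump a b k x = 0"
proof -
  obtain i where "x $ i \<le> a $ i \<or> b $ i \<le> x $ i"
    using assms by (auto simp: mem_box_cart not_less)
  then have "flat 1 (real k * (x $ i - a $ i)) * flat 1 (real k * (b $ i - x $ i)) = 0"
    by (auto simp: flat_def zero_less_mult_iff)
  then show ?thesis unfolding bump_def by (intro prod_zero) auto
qed

lemma bump_tendsto:
  fixes x :: "real ^ 'n :: finite"
  shows "(\<lambda>k. bump a b k x) \<longlonglongrightarrow> indicator (box a b) x"
proof (cases "x \<in> box a b")
  case True
  have *: "(\<lambda>k. flat 1 (real k * s)) \<longlonglongrightarrow> 1" if "s > 0" for s
  proof -
    have "(\<lambda>k. exp (- (inverse (real k) * inverse s))) \<longlonglongrightarrow> exp (- (0 * inverse s))"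
      by (intro tendsto_intros lim_inverse_n)
    then have "(\<lambda>k. exp (- (inverse (real k) * inverse s))) \<longlonglongrightarrow> 1" by simp
    then show ?thesis
    proof (rule Lim_transform_eventually)
      \<comment> \<open>The two sides differ at \<open>k = 0\<close>: since
        \<open>inverse 0 = 0\<close> the exponential is 1, whereas
        \<open>flat 1 0 = 0\<close>.\<close>
      show "\<forall>\<^sub>F k in sequentially. exp (- (inverse (real k) * inverse s)) = flat 1 (real k * s)"
        using eventually_gt_at_top[of 0] by eventually_elim (use that in \<open>auto simp: flat_def\<close>)
    qed
  qed
  have "(\<lambda>k. bump a b k x) \<longlonglongrightarrow> (\<Prod>i\<in>(UNIV::'n set). 1 * 1)"
    unfolding bump_def using True by (intro tendsto_prod tendsto_mult *) (auto simp: mem_box_cart)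
  then show ?thesis using True by simp
qed (simp add: bump_eq_0)

lemma bump_schwartz: "(\<lambda>x. of_real (bump a b k x)) \<in> (schwartz :: (real ^ 'n :: finite \<Rightarrow> complex) set)"
proof (rule smooth_alg_schwartz[of _ a b])
  \<comment> \<open>Each factor is rewritten with an affine argument in one coordinate; the upper
    faces get the slope \<open>- real k\<close>.\<close>
  have flat: "smooth_alg (\<lambda>x::real^'n. complex_of_real (flat 1 (real k * (x $ i - a $ i))))"
      "smooth_alg (\<lambda>x::real^'n. complex_of_real (flat 1 (real k * (b $ i - x $ i))))" for i
    using smooth_alg.flat[of 1 "real k" i "- real k * a $ i"]
      smooth_alg.flat[of 1 "- real k" i "real k * b $ i"]
    by (simp_all add: algebra_simps)
  have "smooth_alg (\<lambda>x::real^'n. \<Prod>i\<in>I. complex_of_real (flat 1 (real k * (x $ i - a $ i))) *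
      of_real (flat 1 (real k * (b $ i - x $ i))))" if "finite I" for I
    using that
  proof (induction I)
    case empty then show ?case by (simp add: smooth_alg.const)
  next
    case (insert j I)
    then show ?case by (simp add: smooth_alg.mult flat)
  qed
  from this[of UNIV] show "smooth_alg (\<lambda>x::real^'n. complex_of_real (bump a b k x))"
    by (simp add: bump_def)
qed (use box_subset_cbox in \<open>auto intro!: bump_eq_0\<close>)

section \<open>Uniqueness of the representing function\<close>

text \<open>By Lebesgue differentiation, almost every value is the limit of averages over cubes
  shrinking to the point, and all these averages are 0.\<close>

lemma negligible_if_integral_cbox_eq_0:
  fixes h :: "'a :: euclidean_space \<Rightarrow> 'b :: euclidean_space"
  assumes "\<And>a b. h integrable_on cbox a b" "\<And>a b. integral (cbox a b) h = 0"
  shows "negligible {x. h x \<noteq> 0}"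
proof -
  obtain N where N: "negligible N" "\<And>x e. x \<notin> N \<Longrightarrow> 0 < e \<Longrightarrow>
     \<exists>d>0. \<forall>t. 0 < t \<and> t < d \<longrightarrow>
        norm (integral (cbox x (x + t *\<^sub>R One)) h /\<^sub>R t ^ DIM('a) - h x) < e"
    using integrable_ccontinuous_explicit[OF assms(1)] by blast
  have "h x = 0" if "x \<notin> N" for x
  proof (rule ccontr)
    assume "h x \<noteq> 0"
    with N(2)[OF that, of "norm (h x)"] obtain d where "d > 0" "\<forall>t. 0 < t \<and> t < d \<longrightarrow>
        norm (integral (cbox x (x + t *\<^sub>R One)) h /\<^sub>R t ^ DIM('a) - h x) < norm (h x)"
      by auto
    then show False using assms(2) by (auto dest!: spec[of _ "d / 2"])
  qed
  then show ?thesis by (intro negligible_subset[OF N(1)]) auto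
qed

text \<open>The difference \<open>u\<close> integrates to 0 against every bump. Dominated
  convergence turns this into integral 0 over every box.\<close>

lemma represents_unique:
  fixes g h :: "real ^ 'n :: finite \<Rightarrow> complex"
  assumes "locally_integrable g" "represents g T" "locally_integrable h" "represents h T"
  shows "negligible {x. g x \<noteq> h x}"
proof -
  define u where "u = (\<lambda>x. g x - h x)"
  have u: "u absolutely_integrable_on cbox a b" for a b
    using assms unfolding u_def locally_integrable_def by (auto intro: set_integral_diff)
  have "(LINT x|lebesgue. of_real (bump a b k x) * u x) = 0" for a b k
    using assms(2,4)[unfolded represents_def, rule_format, OF bump_schwartz[of a b k]]
    by (simp add: u_def algebra_simps)
  moreover have "integrable lebesgue (\<lambda>x. of_real (bump a b k x) * u x)" for a b k
    using assms(2,4)[unfolded represents_def, rule_format, OF bump_schwartz[of a b k]]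
    by (simp add: u_def algebra_simps)
  moreover have "(\<lambda>k. LINT x|lebesgue. of_real (bump a b k x) * u x)
      \<longlonglongrightarrow> (LINT x|lebesgue. of_real (indicator (box a b) x) * u x)" for a b
  proof (rule integral_dominated_convergence)
    \<comment> \<open>The bumps lie between 0 and 1 and vanish off the box, so \<open>u\<close> cut
      off to the closed box dominates; local integrability makes it integrable.\<close>
    show "integrable lebesgue (\<lambda>x. norm (indicator (cbox a b) x *\<^sub>R u x))"
      using u[of a b] unfolding set_integrable_def by (rule integrable_norm)
    show "AE x in lebesgue. norm (complex_of_real (bump a b k x) * u x)
        \<le> norm (indicator (cbox a b) x *\<^sub>R u x)" for k
    proof (rule AE_I2)
      fix x
      show "norm (complex_of_real (bump a b k x) * u x) \<le> norm (indicator (cbox a b) x *\<^sub>R u x)"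
        using bump_bounds[of a b k x] bump_eq_0[of x a b k] box_subset_cbox[of a b]
        by (cases "x \<in> box a b") (auto simp: norm_mult mult_left_le_one_le)
    qed
    show "AE x in lebesgue. (\<lambda>k. of_real (bump a b k x) * u x)
        \<longlonglongrightarrow> of_real (indicator (box a b) x) * u x"
      by (auto intro!: AE_I2 tendsto_intros bump_tendsto)
    show "(\<lambda>x. of_real (indicator (box a b) x) * u x) \<in> borel_measurable lebesgue"
    proof -
      have "set_integrable lebesgue (box a b) u"
        by (rule set_integrable_subset[OF u[of a b]]) (auto simp: box_subset_cbox)
      then show ?thesis
        by (simp add: set_integrable_def scaleR_conv_of_real borel_measurable_integrable)
    qed
  qed (use calculation(2) in \<open>auto intro: borel_measurable_integrable\<close>)
  ultimately have "(LINT x|lebesgue. of_real (indicator (box a b) x) * u x) = 0" for a b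
    by (simp add: LIMSEQ_const_iff)
  then have "(LINT x:box a b|lebesgue. u x) = 0" for a b
    by (simp add: set_lebesgue_integral_def scaleR_conv_of_real)
  moreover have "set_integrable lebesgue (box a b) u" for a b
    by (rule set_integrable_subset[OF u[of a b]]) (auto simp: box_subset_cbox)
  ultimately have "integral (cbox a b) u = 0" for a b
    by (metis set_lebesgue_integral_eq_integral(2) integral_open_interval)
  then have "negligible {x. u x \<noteq> 0}"
    using u by (intro negligible_if_integral_cbox_eq_0) (auto intro: set_lebesgue_integral_eq_integral(1))
  then show ?thesis by (simp add: u_def)
qed

subsection \<open>Dyadic cubes and the Calderon--Zygmund decomposition\<close>

text \<open>For \<open>s > 0\<close> these are the cells of the half-open grid of side
  \<open>s / 2 ^ k\<close> anchored at \<open>a\<close>, addressed by any point inside. Equality of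
  floors is an equivalence relation, so two cells of the same level are equal or disjoint.\<close>

definition dyadic :: "real ^ 'n \<Rightarrow> real \<Rightarrow> nat \<Rightarrow> real ^ 'n \<Rightarrow> (real ^ 'n) set" where
  "dyadic a s k x = {y. \<forall>i. \<lfloor>2 ^ k * (y $ i - a $ i) / s\<rfloor> = \<lfloor>2 ^ k * (x $ i - a $ i) / s\<rfloor>}"

lemma dyadic_refl [simp]: "x \<in> dyadic a s k x"
  by (simp add: dyadic_def)

lemma dyadic_eq: "y \<in> dyadic a s k x \<Longrightarrow> dyadic a s k y = dyadic a s k x"
  by (simp add: dyadic_def)

text \<open>This is the nesting of dyadic intervals: halving the index at one level gives the index
  at the level above.\<close>

lemma floor_eq_floor_double_div_2: "\<lfloor>u\<rfloor> = \<lfloor>2 * u\<rfloor> div 2" for u :: real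
  by linarith

lemma dyadic_antimono:
  assumes "j \<le> k"
  shows "dyadic a s k x \<subseteq> dyadic a s j x"
  using assms
proof (induction k rule: dec_induct)
  case (step k)
  have "dyadic a s (Suc k) x \<subseteq> dyadic a s k x"
    unfolding dyadic_def
  proof clarify
    fix y i
    assume "\<forall>i. \<lfloor>2 ^ Suc k * (y $ i - a $ i) / s\<rfloor> = \<lfloor>2 ^ Suc k * (x $ i - a $ i) / s\<rfloor>"
    then show "\<lfloor>2 ^ k * (y $ i - a $ i) / s\<rfloor> = \<lfloor>2 ^ k * (x $ i - a $ i) / s\<rfloor>"
      using floor_eq_floor_double_div_2[of "2 ^ k * (y $ i - a $ i) / s"]
        floor_eq_floor_double_div_2[of "2 ^ k * (x $ i - a $ i) / s"]
      by (simp add: mult.assoc)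
  qed
  with step show ?case by blast
qed simp

text \<open>The point \<open>c\<close> is the lower corner of the grid cell that contains
  \<open>x\<close>.\<close>

lemma dyadic_altdef:
  fixes a x :: "real ^ 'n" and k :: nat
  assumes "s > 0"
  defines "c \<equiv> (\<chi> i. a $ i + s / 2 ^ k * \<lfloor>2 ^ k * (x $ i - a $ i) / s\<rfloor>)"
  shows "dyadic a s k x = {y. \<forall>i. c $ i \<le> y $ i \<and> y $ i < c $ i + s / 2 ^ k}"
proof -
  have "\<lfloor>2 ^ k * (u - v) / s\<rfloor> = m \<longleftrightarrow> v + s / 2 ^ k * m \<le> u \<and> u < v + s / 2 ^ k * m + s / 2 ^ k"
    for u v and m :: int
    using assms(1) by (simp add: floor_eq_iff field_simps)
  then show ?thesis by (simp add: dyadic_def c_def)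
qed

lemma dyadic_0_altdef:
  assumes "s > 0"
  shows "dyadic a s 0 a = {y. \<forall>i. a $ i \<le> y $ i \<and> y $ i < a $ i + s}"
  using dyadic_altdef[OF assms, of a 0 a] by simp

lemma half_open_cube_null:
  fixes c :: "real ^ 'n :: finite"
  shows "cbox c (c + (\<chi> i. r)) - {y. \<forall>i. c $ i \<le> y $ i \<and> y $ i < c $ i + r} \<in> null_sets lebesgue"
proof -
  have "negligible (cbox c (c + (\<chi> i. r)) - {y. \<forall>i. c $ i \<le> y $ i \<and> y $ i < c $ i + r})"
    by (rule negligible_subset[OF negligible_frontier_interval]) (auto simp: mem_box_cart intro: less_imp_le)
  then show ?thesis by (simp add: negligible_iff_null_sets)
qed

lemma measure_cube:
  fixes c :: "real ^ 'n :: finite"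
  assumes "r \<ge> 0"
  shows "measure lebesgue (cbox c (c + (\<chi> i. r))) = r ^ CARD('n)"
proof -
  have "cbox c (c + (\<chi> i. r)) \<noteq> {}"
    using assms by (auto simp: interval_ne_empty_cart)
  then show ?thesis by (simp add: content_cbox_cart)
qed

text \<open>This passes from the half-open cells, which partition space, to the closed cubes, for
  which mean oscillations are controlled.\<close>

lemma dyadic_cube:
  fixes x :: "real ^ 'n :: finite"
  assumes "s > 0"
  obtains Q where "Q \<in> cubes" "dyadic a s k x \<subseteq> Q" "Q - dyadic a s k x \<in> null_sets lebesgue"
    "measure lebesgue Q = (s / 2 ^ k) ^ CARD('n)"
proof -
  define c where "c = (\<chi> i. a $ i + s / 2 ^ k * \<lfloor>2 ^ k * (x $ i - a $ i) / s\<rfloor>)"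
  note D = dyadic_altdef[OF assms, of a k x, folded c_def]
  let ?Q = "cbox c (c + (\<chi> i. s / 2 ^ k))"
  show thesis
  proof
    show "?Q \<in> cubes" unfolding cubes_def using assms by (auto intro!: exI[of _ c] exI[of _ "s / 2 ^ k"])
    show "dyadic a s k x \<subseteq> ?Q" unfolding D by (auto simp: mem_box_cart less_imp_le)
    show "?Q - dyadic a s k x \<in> null_sets lebesgue" unfolding D by (rule half_open_cube_null)
    show "measure lebesgue ?Q = (s / 2 ^ k) ^ CARD('n)" by (rule measure_cube) (use assms in simp)
  qed
qed

lemma cubes_lmeasurable: "Q \<in> cubes \<Longrightarrow> Q \<in> lmeasurable"
  by (auto simp: cubes_def)

lemma sets_and_emeasure_eq_if_diff_null:
  assumes "D \<subseteq> Q" "Q - D \<in> null_sets M" "Q \<in> sets M"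
  shows "D \<in> sets M" "emeasure M D = emeasure M Q"
proof -
  have D: "D = Q - (Q - D)" using assms(1) by blast
  show "D \<in> sets M" by (subst D) (use assms in blast)
  show "emeasure M D = emeasure M Q" by (subst D) (rule emeasure_Diff_null_set[OF assms(2,3)])
qed

lemma dyadic_measurable:
  fixes x :: "real ^ 'n :: finite"
  assumes "s > 0"
  shows "dyadic a s k x \<in> sets lebesgue"
    "emeasure lebesgue (dyadic a s k x) = ennreal ((s / 2 ^ k) ^ CARD('n))"
proof -
  obtain Q where Q: "Q \<in> cubes" "dyadic a s k x \<subseteq> Q" "Q - dyadic a s k x \<in> null_sets lebesgue"
    "measure lebesgue Q = (s / 2 ^ k) ^ CARD('n)"
    by (rule dyadic_cube[OF assms])
  note * = cubes_lmeasurable[OF Q(1)]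
  show "dyadic a s k x \<in> sets lebesgue"
    by (rule sets_and_emeasure_eq_if_diff_null(1)[OF Q(2,3)]) (use * in blast)
  show "emeasure lebesgue (dyadic a s k x) = ennreal ((s / 2 ^ k) ^ CARD('n))"
    using sets_and_emeasure_eq_if_diff_null(2)[OF Q(2,3)] * emeasure_eq_measure2[OF *] Q(4) by (auto simp: fmeasurableD)
qed

text \<open>The measure depends on the level alone, so \<open>x\<close> and \<open>y\<close> are
  unrelated. The factor is the loss in passing to a parent cube.\<close>

lemma emeasure_dyadic_Suc:
  fixes x :: "real ^ 'n :: finite"
  assumes "s > 0"
  shows "emeasure lebesgue (dyadic a s k x) = 2 ^ CARD('n) * emeasure lebesgue (dyadic a s (Suc k) y)"
proof -
  have "(2::ennreal) ^ CARD('n) = ennreal (2 ^ CARD('n))"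
    by (simp flip: ennreal_power)
  then show ?thesis
    unfolding dyadic_measurable(2)[OF assms]
    using assms by (simp add: power_divide power_mult_distrib field_simps flip: ennreal_mult)
qed

text \<open>A cell is determined by its level and its vector of integer indices, of which there are
  only countably many.\<close>

lemma countable_dyadic: "countable (range (\<lambda>(k, x :: real ^ 'n :: finite). dyadic a s k x))"
proof -
  have "range (\<lambda>(k, x). dyadic a s k x) \<subseteq>
      range (\<lambda>(k, m :: 'n \<Rightarrow> int). {y. \<forall>i. \<lfloor>2 ^ k * (y $ i - a $ i) / s\<rfloor> = m i})"
    unfolding dyadic_def by force
  then show ?thesis by (rule countable_subset) simp
qed

lemma dyadic_subset_open:
  fixes x :: "real ^ 'n :: finite"
  assumes "s > 0" "open U" "x \<in> U"
  shows "\<exists>k. dyadic a s k x \<subseteq> U"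
proof -
  obtain e where e: "e > 0" "ball x e \<subseteq> U"
    using assms(2,3) open_contains_ball by blast
  \<comment> \<open>The points of a cell differ by at most \<open>s / 2 ^ k\<close> in each
    coordinate, hence by at most \<open>CARD('n) * s / 2 ^ k\<close> in norm; this \<open>k\<close>
    makes that smaller than \<open>e\<close>.\<close>
  obtain k where k: "real CARD('n) * s / e < 2 ^ k"
    using real_arch_pow[of 2 "real CARD('n) * s / e"] by auto
  have "y \<in> ball x e" if y: "y \<in> dyadic a s k x" for y
  proof -
    note D = dyadic_altdef[OF assms(1), of a k x]
    have xD: "x \<in> dyadic a s k x" by simp
    have "norm (x - y) \<le> (\<Sum>i\<in>UNIV. \<bar>(x - y) $ i\<bar>)" by (rule norm_le_l1_cart)
    also have "\<dots> \<le> (\<Sum>i\<in>(UNIV::'n set). s / 2 ^ k)"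
    proof (rule sum_mono)
      fix i
      show "\<bar>(x - y) $ i\<bar> \<le> s / 2 ^ k"
        using xD[unfolded D] y[unfolded D] by (auto dest!: spec[of _ i])
    qed
    also have "\<dots> < e" using k e assms(1) by (simp add: field_simps)
    finally show ?thesis by (simp add: dist_norm)
  qed
  with e(2) show ?thesis by blast
qed

section \<open>Selection of maximal dyadic cubes\<close>

text \<open>The maximal dyadic subcubes of the top cube that satisfy \<open>P\<close>.\<close>

definition stopping_cubes ::
  "real ^ 'n \<Rightarrow> real \<Rightarrow> ((real ^ 'n) set \<Rightarrow> bool) \<Rightarrow> (real ^ 'n) set set" where
  "stopping_cubes a s P = {dyadic a s k x | k x.
     x \<in> dyadic a s 0 a \<and> P (dyadic a s k x) \<and> (\<forall>j<k. \<not> P (dyadic a s j x))}"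

lemma countable_stopping_cubes: "countable (stopping_cubes a s P)"
  by (rule countable_subset[OF _ countable_dyadic[of a s]]) (auto simp: stopping_cubes_def)

text \<open>A common point \<open>z\<close> can address both cubes and all their ancestors. Both
  levels are then the first at which the cube of \<open>z\<close> satisfies \<open>P\<close>, so
  they coincide.\<close>

lemma disjoint_stopping_cubes: "disjoint_family_on (\<lambda>D. D) (stopping_cubes a s P)"
  unfolding disjoint_family_on_def
proof (intro ballI impI)
  fix D E assume "D \<in> stopping_cubes a s P" "E \<in> stopping_cubes a s P" "D \<noteq> E"
  then obtain k x l y where
    D: "D = dyadic a s k x" "P (dyadic a s k x)" "\<And>j. j < k \<Longrightarrow> \<not> P (dyadic a s j x)" and
    E: "E = dyadic a s l y" "P (dyadic a s l y)" "\<And>j. j < l \<Longrightarrow> \<not> P (dyadic a s j y)"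
    unfolding stopping_cubes_def by blast
  have False if "z \<in> D" "z \<in> E" for z
  proof -
    have Dz: "dyadic a s j x = dyadic a s j z" if "j \<le> k" for j
      using \<open>z \<in> D\<close> D(1) dyadic_antimono[OF that] dyadic_eq by blast
    have Ez: "dyadic a s j y = dyadic a s j z" if "j \<le> l" for j
      using \<open>z \<in> E\<close> E(1) dyadic_antimono[OF that] dyadic_eq by blast
    have "k = l"
      using D(2,3) E(2,3) Dz Ez by (metis nat_le_linear nat_less_le order_refl)
    then show False using Dz Ez D(1) E(1) \<open>D \<noteq> E\<close> by simp
  qed
  then show "D \<inter> E = {}" by blast
qed

lemma Union_stopping_cubes:
  "\<Union> (stopping_cubes a s P) = {x \<in> dyadic a s 0 a. \<exists>k. P (dyadic a s k x)}"
proof (intro equalityI subsetI)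
  fix z assume "z \<in> \<Union> (stopping_cubes a s P)"
  then obtain k x where x: "z \<in> dyadic a s k x" "x \<in> dyadic a s 0 a" "P (dyadic a s k x)"
    unfolding stopping_cubes_def by blast
  then show "z \<in> {x \<in> dyadic a s 0 a. \<exists>k. P (dyadic a s k x)}"
    using dyadic_antimono[of 0 k a s x] dyadic_eq[OF x(1)] dyadic_eq[OF x(2)] by (auto intro: exI[of _ k])
next
  fix x assume x: "x \<in> {x \<in> dyadic a s 0 a. \<exists>k. P (dyadic a s k x)}"
  \<comment> \<open>The first level at which the cube of \<open>x\<close> satisfies \<open>P\<close>
    gives the maximal such cube.\<close>
  define k where "k = (LEAST k. P (dyadic a s k x))"
  have "P (dyadic a s k x)" unfolding k_def by (rule LeastI_ex) (use x in blast)
  moreover have "\<not> P (dyadic a s j x)" if "j < k" for j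
    using that not_less_Least unfolding k_def by blast
  ultimately show "x \<in> \<Union> (stopping_cubes a s P)"
    using x unfolding stopping_cubes_def by (auto intro!: exI[of _ "dyadic a s k x"])
qed

section \<open>Density bounds and averages over dyadic cubes\<close>

text \<open>Integration over \<open>count_space\<close> sums the estimates for the single sets. Two
  measures and two families are allowed, as Lebesgue measure is compared with a density in both
  directions, and level sets with the cubes that contain them.\<close>

lemma emeasure_UN_le:
  assumes I: "countable I" and X: "\<And>i. i \<in> I \<Longrightarrow> X i \<in> sets M" "disjoint_family_on X I"
    and Y: "\<And>i. i \<in> I \<Longrightarrow> Y i \<in> sets N" "disjoint_family_on Y I"
    and le: "\<And>i. i \<in> I \<Longrightarrow> emeasure M (X i) \<le> c * emeasure N (Y i)"
  shows "emeasure M (\<Union>i\<in>I. X i) \<le> c * emeasure N (\<Union>i\<in>I. Y i)"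
proof -
  have "emeasure M (\<Union>i\<in>I. X i) = (\<integral>\<^sup>+i. emeasure M (X i) \<partial>count_space I)"
    using I X by (intro emeasure_UN_countable) auto
  also have "\<dots> \<le> (\<integral>\<^sup>+i. c * emeasure N (Y i) \<partial>count_space I)"
    using le by (intro nn_integral_mono) auto
  also have "\<dots> = c * (\<integral>\<^sup>+i. emeasure N (Y i) \<partial>count_space I)"
    by (rule nn_integral_cmult) auto
  also have "(\<integral>\<^sup>+i. emeasure N (Y i) \<partial>count_space I) = emeasure N (\<Union>i\<in>I. Y i)"
    using I Y by (intro emeasure_UN_countable[symmetric]) auto
  finally show ?thesis .
qed

text \<open>Splitting \<open>f\<close> into \<open>c\<close> and the excess \<open>f - c\<close> on
  \<open>A\<close> shows that the excess has integral 0, although it is positive at every point of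
  \<open>A\<close>.\<close>

lemma null_set_if_density_le:
  fixes f :: "'a \<Rightarrow> ennreal"
  assumes [measurable]: "f \<in> borel_measurable M" "A \<in> sets M"
    and fin: "emeasure M A < \<infinity>" "c < \<infinity>"
    and gt: "\<And>x. x \<in> A \<Longrightarrow> f x > c"
    and le: "emeasure (density M f) A \<le> c * emeasure M A"
  shows "A \<in> null_sets M"
proof -
  have "emeasure (density M f) A = (\<integral>\<^sup>+x. c * indicator A x + (f x - c) * indicator A x \<partial>M)"
    unfolding emeasure_density[OF assms(1,2)]
    by (intro nn_integral_cong) (use gt in \<open>auto simp: indicator_def less_imp_le intro!: add_diff_inverse_ennreal[symmetric]\<close>)
  also have "\<dots> = c * emeasure M A + (\<integral>\<^sup>+x. (f x - c) * indicator A x \<partial>M)"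
    by (subst nn_integral_add) (auto simp: nn_integral_cmult_indicator)
  finally have "c * emeasure M A + (\<integral>\<^sup>+x. (f x - c) * indicator A x \<partial>M) \<le> c * emeasure M A + 0"
    using le by simp
  \<comment> \<open>Cancelling this term in \<open>ennreal\<close> requires it to be finite.\<close>
  moreover have "c * emeasure M A \<noteq> \<infinity>"
    using fin by (simp add: ennreal_mult_eq_top_iff less_top[symmetric])
  ultimately have "(\<integral>\<^sup>+x. (f x - c) * indicator A x \<partial>M) = 0"
    by (subst (asm) ennreal_add_left_cancel_le) auto
  then have "AE x in M. (f x - c) * indicator A x = 0"
    by (subst (asm) nn_integral_0_iff_AE) auto
  then have "AE x in M. x \<notin> A"
  proof eventually_elim
    case (elim x)
    then show ?case using gt[of x] by (auto simp: diff_eq_0_iff_ennreal)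
  qed
  then show ?thesis by (subst AE_iff_null_sets) auto
qed

text \<open>Replaces the Lebesgue differentiation theorem: cover \<open>A\<close> by the maximal dyadic cubes that lie in
  an open set only slightly larger than \<open>A\<close>.\<close>

lemma null_set_if_dyadic_averages_le:
  fixes f :: "real ^ 'n :: finite \<Rightarrow> ennreal"
  assumes s: "s > 0" and f [measurable]: "f \<in> borel_measurable lebesgue" and lam: "lam < \<infinity>"
    and A [measurable]: "A \<in> sets lebesgue" and sub: "A \<subseteq> dyadic a s 0 a"
    and le: "\<And>x k. x \<in> A \<Longrightarrow>
      emeasure (density lebesgue f) (dyadic a s k x) \<le> lam * emeasure lebesgue (dyadic a s k x)"
    and gt: "\<And>x. x \<in> A \<Longrightarrow> f x > lam"
  shows "A \<in> null_sets lebesgue"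
proof (rule null_set_if_density_le[OF f A _ lam gt])
  have "emeasure lebesgue A \<le> emeasure lebesgue (dyadic a s 0 a)"
    using sub dyadic_measurable[OF s] by (intro emeasure_mono) auto
  also have "\<dots> < \<infinity>" by (simp only: dyadic_measurable(2)[OF s]) simp
  finally show fin: "emeasure lebesgue A < \<infinity>" .
  have eps: "emeasure (density lebesgue f) A \<le> lam * (emeasure lebesgue A + ennreal e)" if "e > 0" for e
  proof -
    obtain U where U: "open U" "A \<subseteq> U" "U - A \<in> lmeasurable" "emeasure lebesgue (U - A) < ennreal e"
      using sets_lebesgue_outer_open[OF A \<open>e > 0\<close>] by blast
    \<comment> \<open>A cube that meets \<open>A\<close> is the dyadic cube of a point of
      \<open>A\<close>, so the hypothesis on averages applies to it.\<close>
    define F where "F = stopping_cubes a s (\<lambda>D. D \<subseteq> U \<and> D \<inter> A \<noteq> {})"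
    have meas: "D \<in> sets lebesgue" if "D \<in> F" for D
      using that dyadic_measurable(1)[OF s] unfolding F_def stopping_cubes_def by blast
    have F_le: "emeasure (density lebesgue f) D \<le> lam * emeasure lebesgue D" if DF: "D \<in> F" for D
    proof -
      obtain k x y where D: "D = dyadic a s k x" "y \<in> D" "y \<in> A"
        using DF unfolding F_def stopping_cubes_def by blast
      then have "D = dyadic a s k y" using dyadic_eq by blast
      with le[OF D(3)] show ?thesis by simp
    qed
    have cover: "A \<subseteq> \<Union>F"
    proof
      fix x assume "x \<in> A"
      then obtain k where "dyadic a s k x \<subseteq> U"
        using dyadic_subset_open[OF s U(1)] U(2) by blast
      then show "x \<in> \<Union>F"
        using \<open>x \<in> A\<close> sub dyadic_refl[of x a s k] unfolding F_def Union_stopping_cubes by blast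
    qed
    have FU: "\<Union>F \<subseteq> U"
      unfolding F_def stopping_cubes_def by blast
    have cF: "countable F" and dF: "disjoint_family_on (\<lambda>D. D) F"
      unfolding F_def by (rule countable_stopping_cubes disjoint_stopping_cubes)+
    have UF: "\<Union>F \<in> sets lebesgue"
      using cF meas by (intro sets.countable_Union) auto
    have "emeasure (density lebesgue f) A \<le> emeasure (density lebesgue f) (\<Union>F)"
      using cover UF by (intro emeasure_mono) auto
    also have "\<dots> \<le> lam * emeasure lebesgue (\<Union>F)"
      using emeasure_UN_le[OF cF, of "\<lambda>D. D" "density lebesgue f" "\<lambda>D. D" lebesgue lam] meas dF F_le
      by simp
    also have "\<dots> \<le> lam * emeasure lebesgue U"
      using FU U(1) by (intro mult_left_mono emeasure_mono) auto
    also have "emeasure lebesgue U \<le> emeasure lebesgue A + emeasure lebesgue (U - A)"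
      using emeasure_subadditive[OF A, of "U - A"] U by (simp add: Un_absorb1 fmeasurableD)
    also have "\<dots> \<le> emeasure lebesgue A + ennreal e"
      using U(4) by (intro add_left_mono) auto
    finally show ?thesis by (simp add: mult_left_mono)
  qed
  show "emeasure (density lebesgue f) A \<le> lam * emeasure lebesgue A"
  proof (rule ennreal_le_epsilon)
    fix e :: real assume "e > 0" "lam * emeasure lebesgue A < top"
    obtain l where l: "lam = ennreal l" "l \<ge> 0" using lam by (cases lam) auto
    \<comment> \<open>Dividing by \<open>l + 1\<close> rather than \<open>l\<close> allows
      \<open>l = 0\<close> and still leaves an error of at most \<open>e\<close>.\<close>
    have "emeasure (density lebesgue f) A \<le> lam * (emeasure lebesgue A + ennreal (e / (l + 1)))"
      using \<open>e > 0\<close> l by (intro eps) auto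
    also have "\<dots> = lam * emeasure lebesgue A + ennreal (l * (e / (l + 1)))"
      using l \<open>e > 0\<close> by (simp add: distrib_left flip: ennreal_mult)
    also have "\<dots> \<le> lam * emeasure lebesgue A + ennreal e"
      using l \<open>e > 0\<close> by (intro add_left_mono ennreal_leI) (simp add: field_simps)
    finally show "emeasure (density lebesgue f) A \<le> lam * emeasure lebesgue A + ennreal e" .
  qed
qed

section \<open>The Calderon--Zygmund decomposition\<close>

text \<open>The family consists of the maximal dyadic cubes with average above \<open>lam\<close>.
  The parent of such a cube has average at most \<open>lam\<close>, which gives the upper bound; a
  point off the family has all its dyadic averages at most \<open>lam\<close>.\<close>

proposition Calderon_Zygmund_decomposition:
  fixes f :: "real ^ 'n :: finite \<Rightarrow> ennreal"
  assumes s: "s > 0" and f [measurable]: "f \<in> borel_measurable lebesgue" and lam: "lam < \<infinity>"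
    and top: "emeasure (density lebesgue f) (dyadic a s 0 a) \<le> lam * emeasure lebesgue (dyadic a s 0 a)"
  obtains F where "countable F" "disjoint_family_on (\<lambda>D. D) F"
    "\<And>D. D \<in> F \<Longrightarrow> D \<in> range (\<lambda>(k, x). dyadic a s k x)"
    "\<And>D. D \<in> F \<Longrightarrow> D \<subseteq> dyadic a s 0 a"
    "\<And>D. D \<in> F \<Longrightarrow> lam * emeasure lebesgue D \<le> emeasure (density lebesgue f) D"
    "\<And>D. D \<in> F \<Longrightarrow> emeasure (density lebesgue f) D \<le> 2 ^ CARD('n) * lam * emeasure lebesgue D"
    "{x \<in> dyadic a s 0 a - \<Union>F. f x > lam} \<in> null_sets lebesgue"
proof -
  define P where "P = (\<lambda>D. lam * emeasure lebesgue D < emeasure (density lebesgue f) D)"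
  define F where "F = stopping_cubes a s P"
  have sub: "D \<subseteq> dyadic a s 0 a" if "D \<in> F" for D
    using that Union_stopping_cubes[of a s P] unfolding F_def by blast
  have meas: "D \<in> sets lebesgue" if "D \<in> F" for D
    using that dyadic_measurable(1)[OF s] unfolding F_def stopping_cubes_def by blast
  have cF: "countable F" unfolding F_def by (rule countable_stopping_cubes)
  have "\<Union>F \<in> sets lebesgue"
    using cF meas by (intro sets.countable_Union) auto
  show thesis
  proof
    show "countable F" by fact
    show "disjoint_family_on (\<lambda>D. D) F" unfolding F_def by (rule disjoint_stopping_cubes)
    show "D \<in> range (\<lambda>(k, x). dyadic a s k x)" if "D \<in> F" for D
      using that unfolding F_def stopping_cubes_def by auto
    show "D \<subseteq> dyadic a s 0 a" if "D \<in> F" for D by (rule sub[OF that])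
    show "lam * emeasure lebesgue D \<le> emeasure (density lebesgue f) D" if "D \<in> F" for D
      using that unfolding F_def stopping_cubes_def P_def by (auto intro: less_imp_le)
    show "emeasure (density lebesgue f) D \<le> 2 ^ CARD('n) * lam * emeasure lebesgue D" if DF: "D \<in> F" for D
    proof -
      obtain k x where D: "D = dyadic a s k x" "x \<in> dyadic a s 0 a" "P D" "\<And>j. j < k \<Longrightarrow> \<not> P (dyadic a s j x)"
        using DF unfolding F_def stopping_cubes_def by blast
      \<comment> \<open>By \<open>top\<close> the top cube is not selected, so every selected cube
        has a parent.\<close>
      have "k \<noteq> 0"
        using D(1,3) top dyadic_eq[OF D(2)] unfolding P_def by (metis not_le)
      then obtain j where j: "k = Suc j" by (cases k) auto
      have "emeasure (density lebesgue f) D \<le> emeasure (density lebesgue f) (dyadic a s j x)"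
        unfolding D(1) j using dyadic_measurable(1)[OF s]
        by (intro emeasure_mono dyadic_antimono) auto
      also have "\<dots> \<le> lam * emeasure lebesgue (dyadic a s j x)"
        using D(4)[of j] j unfolding P_def by simp
      also have "\<dots> = 2 ^ CARD('n) * lam * emeasure lebesgue D"
        unfolding D(1) j emeasure_dyadic_Suc[OF s, of a j x x] by (simp only: mult_ac)
      finally show ?thesis .
    qed
    have D0: "dyadic a s 0 a \<in> sets lebesgue" by (rule dyadic_measurable[OF s])
    show "{x \<in> dyadic a s 0 a - \<Union>F. f x > lam} \<in> null_sets lebesgue" (is "?A \<in> _")
    proof (rule null_set_if_dyadic_averages_le[OF s f lam])
      have "?A = (dyadic a s 0 a - \<Union>F) \<inter> {x \<in> space lebesgue. f x > lam}" by auto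
      also have "\<dots> \<in> sets lebesgue"
        by (intro sets.Int sets.Diff D0 \<open>\<Union>F \<in> sets lebesgue\<close>) measurable
      finally show "?A \<in> sets lebesgue" .
      show "emeasure (density lebesgue f) (dyadic a s k x) \<le> lam * emeasure lebesgue (dyadic a s k x)"
        if "x \<in> ?A" for x k
        using that Union_stopping_cubes[of a s P] unfolding F_def P_def by (auto simp: not_less)
    qed auto
  qed
qed

subsection \<open>The John--Nirenberg inequality\<close>

lemma set_integrable_minus_const:
  fixes g :: "'a :: euclidean_space \<Rightarrow> 'b :: {banach, second_countable_topology}"
  assumes "D \<in> lmeasurable" "set_integrable lebesgue D g"
  shows "set_integrable lebesgue D (\<lambda>x. g x - c)"
proof -
  have "set_integrable lebesgue D (\<lambda>_. c)"
    using assms(1) unfolding set_integrable_def fmeasurable_def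
    by (auto intro!: integrable_scaleR_left integrable_real_indicator)
  with assms(2) show ?thesis by (rule set_integral_diff(1))
qed

text \<open>This links the \<open>ennreal\<close> densities of the decomposition with the real
  integrals in \<open>mean_osc\<close>. Cutting off to \<open>Q\<close> makes the density measurable
  on the whole space.\<close>

lemma emeasure_density_norm_diff:
  fixes g :: "real ^ 'n :: finite \<Rightarrow> complex" and c :: complex
  assumes "Q \<in> lmeasurable" "set_integrable lebesgue Q g"
  defines "f \<equiv> (\<lambda>x. ennreal (indicator Q x * cmod (g x - c)))"
  shows "f \<in> borel_measurable lebesgue"
    and "D \<in> sets lebesgue \<Longrightarrow> D \<subseteq> Q \<Longrightarrow>
      emeasure (density lebesgue f) D = ennreal (LINT x:D|lebesgue. cmod (g x - c))"
proof -
  have i: "set_integrable lebesgue Q (\<lambda>x. cmod (g x - c))"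
    by (intro set_integrable_norm set_integrable_minus_const assms)
  then show f: "f \<in> borel_measurable lebesgue"
    unfolding f_def set_integrable_def by (auto dest: borel_measurable_integrable)
  assume D: "D \<in> sets lebesgue" "D \<subseteq> Q"
  have "set_integrable lebesgue D (\<lambda>x. cmod (g x - c))"
    by (rule set_integrable_subset[OF i D])
  then have iD: "integrable lebesgue (\<lambda>x. indicator D x * cmod (g x - c))"
    by (simp add: set_integrable_def)
  have "emeasure (density lebesgue f) D = (\<integral>\<^sup>+x. f x * indicator D x \<partial>lebesgue)"
    by (rule emeasure_density[OF f D(1)])
  also have "\<dots> = (\<integral>\<^sup>+x. ennreal (indicator D x * cmod (g x - c)) \<partial>lebesgue)"
    by (intro nn_integral_cong) (use D(2) in \<open>auto simp: f_def indicator_def\<close>)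
  also have "\<dots> = ennreal (LINT x|lebesgue. indicator D x * cmod (g x - c))"
    by (rule nn_integral_eq_integral[OF iD]) auto
  finally show "emeasure (density lebesgue f) D = ennreal (LINT x:D|lebesgue. cmod (g x - c))"
    by (simp add: set_lebesgue_integral_def)
qed

text \<open>Subtracting \<open>c\<close> commutes with averaging, and the norm passes under the
  integral. It is used with \<open>c\<close> the average over a larger cube.\<close>

lemma cmod_Avg_minus_le:
  fixes g :: "real ^ 'n :: finite \<Rightarrow> complex"
  assumes D: "D \<in> lmeasurable" "measure lebesgue D > 0" and g: "set_integrable lebesgue D g"
  shows "cmod (Avg D g - c) \<le> (LINT x:D|lebesgue. cmod (g x - c)) / measure lebesgue D"
proof -
  have i: "set_integrable lebesgue D (\<lambda>x. g x - c)"
    by (rule set_integrable_minus_const[OF D(1) g])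
  have c: "set_integrable lebesgue D (\<lambda>_. c)"
    using set_integral_diff(1)[OF g i] by simp
  have "(LINT x:D|lebesgue. c) = of_real (measure lebesgue D) * c"
    using D(1) unfolding set_lebesgue_integral_def fmeasurable_def
    by (simp add: scaleR_conv_of_real)
  then have "Avg D g - c = (LINT x:D|lebesgue. g x - c) / of_real (measure lebesgue D)"
    using D(2) by (simp add: Avg_def set_integral_diff(2)[OF g c] field_simps)
  moreover have "cmod (LINT x:D|lebesgue. g x - c) \<le> (LINT x:D|lebesgue. cmod (g x - c))"
    by (rule set_integral_norm_bound[OF i])
  ultimately show ?thesis
    using D(2) by (simp add: norm_divide divide_right_mono)
qed

text \<open>It serves both to change the domain and to change the integrand on a null set.\<close>

lemma set_lebesgue_integral_cong_null:
  fixes g h :: "real ^ 'n :: finite \<Rightarrow> 'b :: {banach, second_countable_topology}"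
  assumes "set_integrable lebesgue D g" "set_integrable lebesgue E h" "N \<in> null_sets lebesgue"
    "\<And>x. x \<notin> N \<Longrightarrow> x \<in> D \<longleftrightarrow> x \<in> E" "\<And>x. x \<notin> N \<Longrightarrow> g x = h x"
  shows "(LINT x:D|lebesgue. g x) = (LINT x:E|lebesgue. h x)"
  unfolding set_lebesgue_integral_def
proof (rule integral_cong_AE)
  show "AE x in lebesgue. indicator D x *\<^sub>R g x = indicator E x *\<^sub>R h x"
    using AE_not_in[OF assms(3)] by eventually_elim (use assms(4,5) in \<open>auto simp: indicator_def\<close>)
qed (use assms(1,2) in \<open>auto simp: set_integrable_def\<close>)

lemma Avg_eq_if_diff_null:
  fixes g :: "real ^ 'n :: finite \<Rightarrow> complex"
  assumes "D \<subseteq> Q" "Q - D \<in> null_sets lebesgue" "Q \<in> lmeasurable" "set_integrable lebesgue Q g"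
  shows "Avg D g = Avg Q g"
proof -
  have Q: "Q \<in> sets lebesgue" using assms(3) by (rule fmeasurableD)
  note D = sets_and_emeasure_eq_if_diff_null[OF assms(1,2) Q]
  have "set_integrable lebesgue D g"
    by (rule set_integrable_subset[OF assms(4) D(1) assms(1)])
  from set_lebesgue_integral_cong_null[OF this assms(4,2)]
  have "(LINT x:D|lebesgue. g x) = (LINT x:Q|lebesgue. g x)"
    using assms(1) by blast
  moreover have "measure lebesgue D = measure lebesgue Q"
    using D(2) by (simp only: measure_def)
  ultimately show ?thesis by (simp add: Avg_def)
qed

lemma locally_integrable_cube:
  "locally_integrable g \<Longrightarrow> Q \<in> cubes \<Longrightarrow> set_integrable lebesgue Q g"
  by (auto simp: locally_integrable_def cubes_def)

lemma cubes_measure_pos: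
  fixes Q :: "(real ^ 'n :: finite) set"
  assumes "Q \<in> cubes"
  shows "measure lebesgue Q > 0"
proof -
  obtain a s where "Q = cbox a (a + (\<chi> i. s))" "s > 0"
    using assms unfolding cubes_def by blast
  then show ?thesis using measure_cube[of s a] by simp
qed

lemma level_set_measurable:
  fixes g :: "'a :: euclidean_space \<Rightarrow> complex"
  assumes "Q \<in> sets lebesgue" "set_integrable lebesgue Q g"
  shows "{x \<in> Q. cmod (g x - c) > t} \<in> sets lebesgue"
proof -
  have [measurable]: "(\<lambda>x. indicator Q x *\<^sub>R g x) \<in> borel_measurable lebesgue"
    using assms(2) unfolding set_integrable_def by (rule borel_measurable_integrable)
  have "{x \<in> Q. cmod (g x - c) > t} =
      Q \<inter> {x \<in> space lebesgue. cmod (indicator Q x *\<^sub>R g x - c) > t}"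
    by auto
  also have "\<dots> \<in> sets lebesgue"
    by (intro sets.Int assms(1)) measurable
  finally show ?thesis .
qed

text \<open>The dyadic cubes in \<open>F\<close> are half-open; \<open>R D\<close> is the closed cube that differs from \<open>D\<close> by a
  null set.\<close>

lemma Calderon_Zygmund_mean_osc:
  fixes g :: "real ^ 'n :: finite \<Rightarrow> complex"
  assumes g: "locally_integrable g" and osc: "mean_osc Q g \<le> B" and B: "B > 0" and Q: "Q \<in> cubes"
  obtains F :: "(real ^ 'n) set set" and R where "countable F" "disjoint_family_on (\<lambda>D. D) F"
    "\<And>D. D \<in> F \<Longrightarrow> D \<in> sets lebesgue"
    "\<And>D. D \<in> F \<Longrightarrow> R D \<in> cubes \<and> D \<subseteq> R D \<and> emeasure lebesgue (R D) = emeasure lebesgue D"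
    "emeasure lebesgue (\<Union>F) \<le> ennreal (1 / 2) * emeasure lebesgue Q"
    "{x \<in> Q - \<Union>F. cmod (g x - Avg Q g) > 2 * B} \<in> null_sets lebesgue"
    "\<And>D. D \<in> F \<Longrightarrow> cmod (Avg (R D) g - Avg Q g) \<le> 2 ^ (CARD('n) + 1) * B"
proof -
  obtain a s where Q_eq: "Q = cbox a (a + (\<chi> i. s))" and s: "s > 0"
    using Q unfolding cubes_def by blast
  define D0 where "D0 = dyadic a s 0 a"
  define c where "c = Avg Q g"
  define f where "f = (\<lambda>x. ennreal (indicator Q x * cmod (g x - c)))"
  let ?\<nu> = "density lebesgue f"
  have Qm: "Q \<in> lmeasurable" using Q by (rule cubes_lmeasurable)
  note Qs = fmeasurableD[OF Qm]
  note i = locally_integrable_cube[OF g Q]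
  note f = emeasure_density_norm_diff(1)[OF Qm i, of c, folded f_def]
  note \<nu> = emeasure_density_norm_diff(2)[OF Qm i, of _ c, folded f_def]
  have D0: "D0 \<subseteq> Q" "Q - D0 \<in> null_sets lebesgue"
    using half_open_cube_null[of a s]
    by (auto simp: D0_def dyadic_0_altdef[OF s] Q_eq mem_box_cart less_imp_le)
  have \<nu>Q: "emeasure ?\<nu> Q \<le> ennreal B * emeasure lebesgue Q"
  proof -
    have "(LINT x:Q|lebesgue. cmod (g x - c)) = mean_osc Q g * measure lebesgue Q"
      using cubes_measure_pos[OF Q] by (simp add: mean_osc_def c_def)
    also have "\<dots> \<le> B * measure lebesgue Q"
      by (intro mult_right_mono osc) simp
    finally have "emeasure ?\<nu> Q \<le> ennreal (B * measure lebesgue Q)"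
      unfolding \<nu>[OF Qs order_refl] by (rule ennreal_leI)
    then show ?thesis
      using B unfolding emeasure_eq_measure2[OF Qm] by (simp add: ennreal_mult)
  qed
  have "emeasure ?\<nu> D0 \<le> emeasure ?\<nu> Q"
    using D0(1) Qs by (intro emeasure_mono) auto
  also note \<nu>Q
  \<comment> \<open>The height is twice the bound on the average over \<open>Q\<close>; this factor
    2 later yields the halving of the measure.\<close>
  also have "ennreal B * emeasure lebesgue Q \<le> ennreal (2 * B) * emeasure lebesgue D0"
    unfolding sets_and_emeasure_eq_if_diff_null(2)[OF D0 Qs]
    using B by (intro mult_right_mono ennreal_leI) auto
  finally have top: "emeasure ?\<nu> (dyadic a s 0 a) \<le> ennreal (2 * B) * emeasure lebesgue (dyadic a s 0 a)"
    by (simp only: D0_def)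
  obtain F where F: "countable F" "disjoint_family_on (\<lambda>D. D) F"
    "\<And>D. D \<in> F \<Longrightarrow> D \<in> range (\<lambda>(k, x). dyadic a s k x)"
    "\<And>D. D \<in> F \<Longrightarrow> D \<subseteq> D0"
    "\<And>D. D \<in> F \<Longrightarrow> ennreal (2 * B) * emeasure lebesgue D \<le> emeasure ?\<nu> D"
    "\<And>D. D \<in> F \<Longrightarrow> emeasure ?\<nu> D \<le> 2 ^ CARD('n) * ennreal (2 * B) * emeasure lebesgue D"
    "{x \<in> D0 - \<Union>F. f x > ennreal (2 * B)} \<in> null_sets lebesgue"
    by (rule Calderon_Zygmund_decomposition[OF s f _ top, folded D0_def]) (simp, rule that, assumption+)
  have meas: "D \<in> sets lebesgue" if "D \<in> F" for D
    using F(3)[OF that] dyadic_measurable(1)[OF s] by auto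
  have "\<exists>R. R \<in> cubes \<and> D \<subseteq> R \<and> R - D \<in> null_sets lebesgue" if DF: "D \<in> F" for D
  proof -
    obtain k x where D: "D = dyadic a s k x" using F(3)[OF DF] by auto
    show ?thesis unfolding D by (rule dyadic_cube[OF s, of a k x]) blast
  qed
  then obtain R where R: "\<And>D. D \<in> F \<Longrightarrow> R D \<in> cubes \<and> D \<subseteq> R D \<and> R D - D \<in> null_sets lebesgue"
    by metis
  have Rs: "R D \<in> sets lebesgue" if "D \<in> F" for D
    using R[OF that] cubes_lmeasurable by (blast dest: fmeasurableD)
  have RD: "emeasure lebesgue D = emeasure lebesgue (R D)" if "D \<in> F" for D
    using R[OF that] Rs[OF that] by (intro sets_and_emeasure_eq_if_diff_null(2)) auto
  show thesis
  proof
    show "R D \<in> cubes \<and> D \<subseteq> R D \<and> emeasure lebesgue (R D) = emeasure lebesgue D" if "D \<in> F" for D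
      using R[OF that] RD[OF that] by auto
    show "emeasure lebesgue (\<Union>F) \<le> ennreal (1 / 2) * emeasure lebesgue Q"
    proof -
      have inv: "ennreal (1 / (2 * B)) * (ennreal (2 * B) * x) = x" for x
        using B by (simp add: mult.assoc[symmetric] flip: ennreal_mult)
      \<comment> \<open>Each selected cube has average at least \<open>2 * B\<close>, so its measure
        is at most its integral divided by \<open>2 * B\<close>; the integrals add up to at most
        \<open>B\<close> times the measure of \<open>Q\<close>.\<close>
      have "emeasure lebesgue (\<Union>D\<in>F. D) \<le> ennreal (1 / (2 * B)) * emeasure ?\<nu> (\<Union>D\<in>F. D)"
      proof (rule emeasure_UN_le[OF F(1) _ F(2) _ F(2)])
        show "emeasure lebesgue D \<le> ennreal (1 / (2 * B)) * emeasure ?\<nu> D" if "D \<in> F" for D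
          using mult_left_mono[OF F(5)[OF that], of "ennreal (1 / (2 * B))"] unfolding inv by simp
      qed (use meas in auto)
      also have "\<dots> \<le> ennreal (1 / (2 * B)) * emeasure ?\<nu> Q"
        using F(4) D0(1) Qs by (intro mult_left_mono emeasure_mono) auto
      also have "\<dots> \<le> ennreal (1 / (2 * B)) * (ennreal B * emeasure lebesgue Q)"
        by (intro mult_left_mono \<nu>Q) simp
      also have "\<dots> = ennreal (1 / 2) * emeasure lebesgue Q"
        using B by (simp add: mult.assoc[symmetric] flip: ennreal_mult)
      finally show ?thesis by simp
    qed
    show "{x \<in> Q - \<Union>F. cmod (g x - Avg Q g) > 2 * B} \<in> null_sets lebesgue"
      unfolding negligible_iff_null_sets[symmetric]
    proof (rule negligible_subset)
      show "negligible ((Q - D0) \<union> {x \<in> D0 - \<Union>F. f x > ennreal (2 * B)})"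
        unfolding negligible_iff_null_sets by (rule null_sets.Un[OF D0(2) F(7)])
      show "{x \<in> Q - \<Union>F. cmod (g x - Avg Q g) > 2 * B} \<subseteq> (Q - D0) \<union> {x \<in> D0 - \<Union>F. f x > ennreal (2 * B)}"
        using B by (auto simp: f_def c_def ennreal_less_iff)
    qed
    show "cmod (Avg (R D) g - Avg Q g) \<le> 2 ^ (CARD('n) + 1) * B" if DF: "D \<in> F" for D
    proof -
      have DQ: "D \<subseteq> Q" using F(4)[OF DF] D0(1) by blast
      have Dm: "D \<in> lmeasurable"
        by (rule fmeasurableI2[OF Qm DQ meas[OF DF]])
      have iD: "set_integrable lebesgue D g"
        by (rule set_integrable_subset[OF i meas[OF DF] DQ])
      have Rm: "R D \<in> lmeasurable" and iR: "set_integrable lebesgue (R D) g"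
        using R[OF DF] cubes_lmeasurable locally_integrable_cube[OF g] by blast+
      have "measure lebesgue D = measure lebesgue (R D)"
        using RD[OF DF] by (simp only: measure_def)
      then have pos: "measure lebesgue D > 0" using cubes_measure_pos R[OF DF] by metis
      have "Avg (R D) g = Avg D g"
        using R[OF DF] by (intro Avg_eq_if_diff_null[symmetric] Rm iR) auto
      moreover have "cmod (Avg D g - c) \<le> (LINT x:D|lebesgue. cmod (g x - c)) / measure lebesgue D"
        by (rule cmod_Avg_minus_le[OF Dm pos iD])
      \<comment> \<open>The factor combines \<open>2 ^ CARD('n)\<close>, from passing to the parent
        cube, with the height \<open>2 * B\<close>.\<close>
      moreover have "(LINT x:D|lebesgue. cmod (g x - c)) \<le> 2 ^ (CARD('n) + 1) * B * measure lebesgue D"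
      proof -
        have two: "(2::ennreal) ^ CARD('n) = ennreal (2 ^ CARD('n))"
          by (simp flip: ennreal_power)
        have "ennreal (LINT x:D|lebesgue. cmod (g x - c)) \<le> ennreal (2 ^ (CARD('n) + 1) * B * measure lebesgue D)"
          using F(6)[OF DF] B unfolding \<nu>[OF meas[OF DF] DQ] emeasure_eq_measure2[OF Dm] two
          by (simp add: algebra_simps flip: ennreal_mult)
        then show ?thesis
          using B by (subst (asm) ennreal_le_iff) auto
      qed
      ultimately show ?thesis
        using pos unfolding c_def by (smt (verit) pos_divide_le_eq)
    qed
  qed (use F meas in auto)
qed

section \<open>Iteration of the decomposition and exponential decay\<close>

text \<open>Induction on \<open>m\<close> for all cubes at once. Replacing the average over
  \<open>Q\<close> by that over a selected cube uses up one unit of the threshold, and the selected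
  cubes together have at most half the measure.\<close>

proposition John_Nirenberg_iterated:
  fixes g :: "real ^ 'n :: finite \<Rightarrow> complex"
  assumes g: "locally_integrable g" and osc: "\<And>Q. Q \<in> cubes \<Longrightarrow> mean_osc Q g \<le> B" and B: "B > 0"
    and Q: "Q \<in> cubes"
  shows "emeasure lebesgue {x \<in> Q. cmod (g x - Avg Q g) > real m * (2 ^ (CARD('n) + 1) * B)}
    \<le> ennreal ((1 / 2) ^ m) * emeasure lebesgue Q"
  using Q
proof (induction m arbitrary: Q)
  case 0
  have "Q \<in> sets lebesgue" using cubes_lmeasurable[OF 0] by (rule fmeasurableD)
  then have "emeasure lebesgue {x \<in> Q. cmod (g x - Avg Q g) > real 0 * (2 ^ (CARD('n) + 1) * B)}
      \<le> emeasure lebesgue Q"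
    by (intro emeasure_mono) auto
  then show ?case by (simp only: power_0 ennreal_1 mult_1)
next
  case (Suc m)
  define K where "K = 2 ^ (CARD('n) + 1) * B"
  define c where "c = Avg Q g"
  \<comment> \<open>Off the selected cubes, a deviation above \<open>Suc m * K\<close> thus exceeds
    the height \<open>2 * B\<close>, which happens only on a null set.\<close>
  have K: "2 * B \<le> K"
    using B power_increasing[of 1 "CARD('n) + 1" "2::real"] by (simp add: K_def)
  obtain F R where F: "countable F" "disjoint_family_on (\<lambda>D. D) F"
    "\<And>D. D \<in> F \<Longrightarrow> D \<in> sets lebesgue"
    "\<And>D. D \<in> F \<Longrightarrow> R D \<in> cubes \<and> D \<subseteq> R D \<and> emeasure lebesgue (R D) = emeasure lebesgue D"
    "emeasure lebesgue (\<Union>F) \<le> ennreal (1 / 2) * emeasure lebesgue Q"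
    "{x \<in> Q - \<Union>F. cmod (g x - c) > 2 * B} \<in> null_sets lebesgue"
    "\<And>D. D \<in> F \<Longrightarrow> cmod (Avg (R D) g - c) \<le> K"
    by (rule Calderon_Zygmund_mean_osc[OF g osc[OF Suc.prems] B Suc.prems, folded K_def c_def])
      (rule that, assumption+)
  define X where "X D = {x \<in> D. cmod (g x - Avg (R D) g) > real m * K}" for D
  let ?N = "{x \<in> Q - \<Union>F. cmod (g x - c) > 2 * B}"
  have Xs: "X D \<in> sets lebesgue" if "D \<in> F" for D
    unfolding X_def using F(3,4)[OF that] locally_integrable_cube[OF g]
    by (intro level_set_measurable) (auto intro: set_integrable_subset)
  have sub: "{x \<in> Q. cmod (g x - c) > real (Suc m) * K} \<subseteq> ?N \<union> (\<Union>D\<in>F. X D)"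
  proof
    fix x assume x: "x \<in> {x \<in> Q. cmod (g x - c) > real (Suc m) * K}"
    show "x \<in> ?N \<union> (\<Union>D\<in>F. X D)"
    proof (cases "x \<in> \<Union>F")
      case True
      then obtain D where D: "D \<in> F" "x \<in> D" by blast
      have "cmod (g x - c) \<le> cmod (g x - Avg (R D) g) + cmod (Avg (R D) g - c)"
        using norm_triangle_ineq[of "g x - Avg (R D) g" "Avg (R D) g - c"] by simp
      with F(7)[OF D(1)] x have "x \<in> X D"
        using D(2) by (simp add: X_def algebra_simps)
      with D(1) show ?thesis by blast
    next
      case False
      have "K \<le> real (Suc m) * K"
        using K B by (simp add: algebra_simps)
      with x K False show ?thesis by auto
    qed
  qed
  have "emeasure lebesgue {x \<in> Q. cmod (g x - c) > real (Suc m) * K} \<le> emeasure lebesgue (?N \<union> (\<Union>D\<in>F. X D))"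
    using F(1,6) Xs by (intro emeasure_mono sub sets.Un sets.countable_UN') auto
  also have "\<dots> = emeasure lebesgue (\<Union>D\<in>F. X D)"
    using F(1,6) Xs by (subst Un_commute) (intro emeasure_Un_null_set sets.countable_UN', auto)
  also have "\<dots> \<le> ennreal ((1 / 2) ^ m) * emeasure lebesgue (\<Union>D\<in>F. D)"
  proof (rule emeasure_UN_le[OF F(1) Xs _ F(3) F(2)])
    show "disjoint_family_on X F"
      using F(2) unfolding disjoint_family_on_def X_def by blast
    show "emeasure lebesgue (X D) \<le> ennreal ((1 / 2) ^ m) * emeasure lebesgue D" if "D \<in> F" for D
    proof -
      have R: "R D \<in> cubes" "D \<subseteq> R D" "emeasure lebesgue (R D) = emeasure lebesgue D"
        using F(4)[OF that] by auto
      \<comment> \<open>The induction hypothesis speaks of closed cubes, so \<open>D\<close> is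
        enlarged to \<open>R D\<close>, which has the same measure.\<close>
      have "emeasure lebesgue (X D) \<le> emeasure lebesgue {x \<in> R D. cmod (g x - Avg (R D) g) > real m * K}"
        using R(2) level_set_measurable[OF fmeasurableD[OF cubes_lmeasurable[OF R(1)]] locally_integrable_cube[OF g R(1)]]
        by (intro emeasure_mono) (auto simp: X_def)
      also have "\<dots> \<le> ennreal ((1 / 2) ^ m) * emeasure lebesgue (R D)"
        unfolding K_def by (rule Suc.IH[OF R(1)])
      finally show ?thesis by (simp only: R(3))
    qed
  qed auto
  also have "\<dots> \<le> ennreal ((1 / 2) ^ m) * (ennreal (1 / 2) * emeasure lebesgue Q)"
    using F(5) by (intro mult_left_mono) auto
  also have "\<dots> = ennreal ((1 / 2) ^ Suc m) * emeasure lebesgue Q"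
    unfolding power_Suc2 by (subst ennreal_mult) (simp_all add: mult.assoc)
  finally show ?case by (simp only: K_def c_def)
qed

text \<open>The iterated bound is used with \<open>m\<close> the integer part of
  \<open>t / (K * B)\<close>. If the seminorm is 0, every \<open>m > 0\<close> is admissible and the
  level set is null.\<close>

theorem John_Nirenberg:
  fixes g :: "real ^ 'n :: finite \<Rightarrow> complex"
  assumes g: "g \<in> BMO" and Q: "Q \<in> cubes" and t: "t > 0"
  shows "measure lebesgue {x \<in> Q. cmod (g x - Avg Q g) > t} \<le> 2 * measure lebesgue Q *
    (if bmo_seminorm g = 0 then 0 else exp (- (ln 2 / 2 ^ (CARD('n) + 1) * t / bmo_seminorm g)))"
proof -
  have li: "locally_integrable g" and bdd: "bdd_above ((\<lambda>Q. mean_osc Q g) ` cubes)"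
    using g by (auto simp: BMO_def)
  define B where "B = bmo_seminorm g"
  define K :: real where "K = 2 ^ (CARD('n) + 1)"
  have K: "K > 0" by (simp add: K_def)
  have osc: "mean_osc R g \<le> B" if "R \<in> cubes" for R
    unfolding B_def bmo_seminorm_def by (rule cSUP_upper[OF that bdd])
  have "0 \<le> mean_osc Q g"
    unfolding mean_osc_def set_lebesgue_integral_def by (intro divide_nonneg_nonneg integral_nonneg) auto
  with osc[OF Q] have "B \<ge> 0" by linarith
  have Qm: "Q \<in> lmeasurable" using Q by (rule cubes_lmeasurable)
  \<comment> \<open>A positive \<open>B'\<close> above \<open>B\<close> is used because the iterated
    bound requires a positive constant while \<open>B\<close> may be 0.\<close>
  have step: "measure lebesgue {x \<in> Q. cmod (g x - Avg Q g) > t} \<le> (1 / 2) ^ m * measure lebesgue Q"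
    if "B' > 0" "B \<le> B'" "real m * (K * B') \<le> t" for m B'
  proof -
    have "emeasure lebesgue {x \<in> Q. cmod (g x - Avg Q g) > t}
      \<le> emeasure lebesgue {x \<in> Q. cmod (g x - Avg Q g) > real m * (K * B')}"
      using that(3) level_set_measurable[OF fmeasurableD[OF Qm] locally_integrable_cube[OF li Q]]
      by (intro emeasure_mono) auto
    also have "\<dots> \<le> ennreal ((1 / 2) ^ m) * emeasure lebesgue Q"
      unfolding K_def using osc that(2)
      by (intro John_Nirenberg_iterated[OF li _ that(1) Q]) (meson order_trans)
    also have "\<dots> = ennreal ((1 / 2) ^ m * measure lebesgue Q)"
      using Qm by (simp only: emeasure_eq_measure2) (simp flip: ennreal_mult)
    finally show ?thesis
      unfolding measure_def[of _ "{x \<in> Q. cmod (g x - Avg Q g) > t}"] by (intro enn2real_leI) auto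
  qed
  show ?thesis
  proof (cases "B = 0")
    case True
    \<comment> \<open>With \<open>B' = t / (m * K)\<close> the threshold \<open>m * K * B'\<close>
      is exactly \<open>t\<close>.\<close>
    have "measure lebesgue {x \<in> Q. cmod (g x - Avg Q g) > t} \<le> (1 / 2) ^ m * measure lebesgue Q" if "m > 0" for m
      by (rule step[of "t / (real m * K)"]) (use that True t K in auto)
    then have "\<forall>\<^sub>F m in sequentially. measure lebesgue {x \<in> Q. cmod (g x - Avg Q g) > t} \<le> (1 / 2) ^ m * measure lebesgue Q"
      using eventually_gt_at_top[of 0] by (rule eventually_mono[rotated])
    moreover have "(\<lambda>m. (1 / 2) ^ m * measure lebesgue Q) \<longlonglongrightarrow> 0 * measure lebesgue Q"
      by (intro tendsto_mult tendsto_const LIMSEQ_power_zero) auto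
    ultimately have "measure lebesgue {x \<in> Q. cmod (g x - Avg Q g) > t} \<le> 0 * measure lebesgue Q"
      by (intro tendsto_lowerbound[where F = sequentially]) auto
    then show ?thesis using True by (simp add: B_def)
  next
    case False
    with \<open>B \<ge> 0\<close> have "B > 0" by simp
    define u where "u = t / (K * B)"
    \<comment> \<open>Rounding \<open>u\<close> down costs at most one factor 2, which becomes the 2
      in front of the final bound.\<close>
    define m where "m = nat \<lfloor>u\<rfloor>"
    have "u > 0" using t K \<open>B > 0\<close> by (simp add: u_def)
    have m: "real m \<le> u" "u \<le> real m + 1"
      unfolding m_def using \<open>u > 0\<close> by linarith+
    have "(1 / 2) ^ m = exp (- (ln 2 * real m))"
      by (simp add: exp_minus exp_of_nat2_mult power_one_over inverse_eq_divide)
    also have "\<dots> \<le> exp (ln 2 - ln 2 * u)"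
      using m(2) mult_left_mono[of u "real m + 1" "ln 2"] by (simp add: algebra_simps)
    also have "\<dots> = 2 * exp (- (ln 2 * u))"
      by (simp add: exp_diff exp_minus field_simps)
    finally have le: "(1 / 2) ^ m \<le> 2 * exp (- (ln 2 * u))" .
    have "measure lebesgue {x \<in> Q. cmod (g x - Avg Q g) > t} \<le> (1 / 2) ^ m * measure lebesgue Q"
      using m(1) K \<open>B > 0\<close> by (intro step[of B]) (auto simp: u_def field_simps)
    also have "\<dots> \<le> 2 * exp (- (ln 2 * u)) * measure lebesgue Q"
      by (intro mult_right_mono le) simp
    finally show ?thesis using False by (simp add: u_def B_def K_def field_simps)
  qed
qed

section \<open>Transfer to \<open>BMO_alpha\<close>\<close>

text \<open>The averages agree first, and then the deviations from the common average. This makes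
  \<open>bmo_alpha_norm\<close> independent of the chosen representative.\<close>

lemma mean_osc_cong_AE:
  fixes g h :: "real ^ 'n :: finite \<Rightarrow> complex"
  assumes "locally_integrable g" "locally_integrable h" "negligible {x. g x \<noteq> h x}" "Q \<in> cubes"
  shows "mean_osc Q g = mean_osc Q h"
proof -
  note i = locally_integrable_cube[OF assms(1,4)] locally_integrable_cube[OF assms(2,4)]
  have N: "{x. g x \<noteq> h x} \<in> null_sets lebesgue"
    using assms(3) by (simp add: negligible_iff_null_sets)
  have "(LINT x:Q|lebesgue. g x) = (LINT x:Q|lebesgue. h x)"
    by (rule set_lebesgue_integral_cong_null[OF i N]) auto
  then have Avg: "Avg Q g = Avg Q h"
    by (simp only: Avg_def)
  have "(LINT x:Q|lebesgue. cmod (g x - Avg Q h)) = (LINT x:Q|lebesgue. cmod (h x - Avg Q h))"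
    by (rule set_lebesgue_integral_cong_null[OF _ _ N])
      (auto intro!: set_integrable_norm set_integrable_minus_const i cubes_lmeasurable assms(4))
  then show ?thesis by (simp add: mean_osc_def Avg)
qed

text \<open>A distribution determines its representing function only up to null sets, so the
  estimate is claimed for every locally integrable representative \<open>Mb\<close>.\<close>

theorem theorem13p1:
  "\<exists>C1 C2 :: real. C1 > 0 \<and> C2 > 0 \<and>
     (\<forall>(\<alpha> :: real) (b :: ('n :: finite) functional) (Mb :: real ^ 'n \<Rightarrow> complex).
        (\<nexists>k :: int. \<alpha> = of_int k * pi) \<longrightarrow> b \<in> BMO_alpha \<alpha> \<longrightarrow>
        locally_integrable Mb \<longrightarrow> represents Mb (chirp_distr \<alpha> b) \<longrightarrow>
        (\<forall>Q\<in>cubes. \<forall>t>0.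
           measure lebesgue {x\<in>Q. cmod (Mb x - Avg Q Mb) > t}
             \<le> C1 * measure lebesgue Q *
                 (if bmo_alpha_norm \<alpha> b = 0 then 0
                  else exp (- (C2 * t / bmo_alpha_norm \<alpha> b)))))"
proof (intro exI conjI allI impI ballI)
  fix \<alpha> t :: real and b :: "'n functional" and Mb :: "real ^ 'n \<Rightarrow> complex" and Q :: "(real ^ 'n) set"
  assume b: "b \<in> BMO_alpha \<alpha>" and Mb: "locally_integrable Mb" "represents Mb (chirp_distr \<alpha> b)"
    and Q: "Q \<in> cubes" and t: "t > 0"
  \<comment> \<open>This is the choice made inside \<open>bmo_alpha_norm\<close>, so the norm of
    \<open>b\<close> unfolds to the seminorm of \<open>g\<close>.\<close>
  define g where "g = (SOME g. g \<in> BMO \<and> represents g (chirp_distr \<alpha> b))"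
  have "\<exists>g. g \<in> BMO \<and> represents g (chirp_distr \<alpha> b)"
    using b unfolding BMO_alpha_def by blast
  from someI_ex[OF this] have "g \<in> BMO \<and> represents g (chirp_distr \<alpha> b)"
    by (simp only: g_def)
  then have g: "g \<in> BMO" "locally_integrable g" "represents g (chirp_distr \<alpha> b)"
    by (auto simp: BMO_def)
  have "negligible {x. Mb x \<noteq> g x}"
    by (rule represents_unique[OF Mb g(2,3)])
  then have *: "mean_osc R Mb = mean_osc R g" if "R \<in> cubes" for R
    by (rule mean_osc_cong_AE[OF Mb(1) g(2) _ that])
  then have norm: "bmo_alpha_norm \<alpha> b = bmo_seminorm Mb"
    unfolding bmo_alpha_norm_def g_def[symmetric] bmo_seminorm_def by simp
  have "(\<lambda>R. mean_osc R Mb) ` cubes = (\<lambda>R. mean_osc R g) ` cubes"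
    using * by (intro image_cong) auto
  then have "Mb \<in> BMO"
    using g(1) Mb(1) by (simp add: BMO_def)
  \<comment> \<open>Here the constants become \<open>2\<close> and
    \<open>ln 2 / 2 ^ (CARD('n) + 1)\<close>, which involve nothing but the dimension.\<close>
  then show "measure lebesgue {x\<in>Q. cmod (Mb x - Avg Q Mb) > t}
      \<le> 2 * measure lebesgue Q * (if bmo_alpha_norm \<alpha> b = 0 then 0
          else exp (- (ln 2 / 2 ^ (CARD('n) + 1) * t / bmo_alpha_norm \<alpha> b)))"
    unfolding norm using Q t by (rule John_Nirenberg)
qed auto

end
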